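(* If $t=2m+1\ge3$ with $m$ an integer, then $$\rho(A_{2^t})\ge\sqrt{15\cdot2^{4m}\bigl(2^{4m}-1\bigr)}.$$ This is strictly stronger than the bound $\rho(A_{2^t})\ge2^{4m}-2$; that is, $\sqrt{15\cdot2^{4m}(2^{4m}-1)}>2^{4m}-2$.
   Context: For $n\ge2$, $\mathbb{L}_n=\{a+bi+cj+dk: a,b,c,d\in\mathbb{Z}/n\mathbb{Z}\}$ is the ring of Lipschitz quaternions modulo $n$, with the usual relations $i^2=j^2=k^2=-1$, $ij=k=-ji$, $jk=i=-kj$, $ki=j=-ik$ taken modulo $n$. A nonzero element $x$ of a ring is a zero divisor if $xy=0$ or $yx=0$ for some nonzero $y$. $G_n=\Gamma(\mathbb{L}_n)$ is the simple undirected graph whose vertices are the nonzero zero divisors of $\mathbb{L}_n$, distinct $x,y$ being adjacent iff $xy=0$ or $yx=0$; $A_n=A(G_n)$ is its adjacency matrix. $\rho$ denotes the spectral radius. *)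

theory Defs
  imports
    "HOL-Number_Theory.Residues"
    "Jordan_Normal_Form.Spectral_Radius"
    "Graph_Theory.Pair_Digraph"
begin

section \<open>Lipschitz quaternions modulo n\<close>

text \<open>\<open>Quat a b c d\<close> stands for $a + bi + cj + dk$.\<close>

datatype 'a quat = Quat (qre: 'a) (qi: 'a) (qj: 'a) (qk: 'a)

definition quaternion_ring :: "('a, 'b) ring_scheme \<Rightarrow> 'a quat ring" where
  "quaternion_ring R = \<lparr>
     carrier = {Quat a b c d | a b c d.
       a \<in> carrier R \<and> b \<in> carrier R \<and> c \<in> carrier R \<and> d \<in> carrier R},
     monoid.mult = (\<lambda>x y. Quat
       (qre x \<otimes>\<^bsub>R\<^esub> qre y \<ominus>\<^bsub>R\<^esub> qi x \<otimes>\<^bsub>R\<^esub> qi y \<ominus>\<^bsub>R\<^esub> qj x \<otimes>\<^bsub>R\<^esub> qj y \<ominus>\<^bsub>R\<^esub> qk x \<otimes>\<^bsub>R\<^esub> qk y)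
       (qre x \<otimes>\<^bsub>R\<^esub> qi y \<oplus>\<^bsub>R\<^esub> qi x \<otimes>\<^bsub>R\<^esub> qre y \<oplus>\<^bsub>R\<^esub> qj x \<otimes>\<^bsub>R\<^esub> qk y \<ominus>\<^bsub>R\<^esub> qk x \<otimes>\<^bsub>R\<^esub> qj y)
       (qre x \<otimes>\<^bsub>R\<^esub> qj y \<ominus>\<^bsub>R\<^esub> qi x \<otimes>\<^bsub>R\<^esub> qk y \<oplus>\<^bsub>R\<^esub> qj x \<otimes>\<^bsub>R\<^esub> qre y \<oplus>\<^bsub>R\<^esub> qk x \<otimes>\<^bsub>R\<^esub> qi y)
       (qre x \<otimes>\<^bsub>R\<^esub> qk y \<oplus>\<^bsub>R\<^esub> qi x \<otimes>\<^bsub>R\<^esub> qj y \<ominus>\<^bsub>R\<^esub> qj x \<otimes>\<^bsub>R\<^esub> qi y \<oplus>\<^bsub>R\<^esub> qk x \<otimes>\<^bsub>R\<^esub> qre y)),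
     one = Quat \<one>\<^bsub>R\<^esub> \<zero>\<^bsub>R\<^esub> \<zero>\<^bsub>R\<^esub> \<zero>\<^bsub>R\<^esub>,
     zero = Quat \<zero>\<^bsub>R\<^esub> \<zero>\<^bsub>R\<^esub> \<zero>\<^bsub>R\<^esub> \<zero>\<^bsub>R\<^esub>,
     add = (\<lambda>x y. Quat
       (qre x \<oplus>\<^bsub>R\<^esub> qre y) (qi x \<oplus>\<^bsub>R\<^esub> qi y) (qj x \<oplus>\<^bsub>R\<^esub> qj y) (qk x \<oplus>\<^bsub>R\<^esub> qk y))\<rparr>"

definition lipschitz_ring :: "nat \<Rightarrow> int quat ring" where
  "lipschitz_ring n = quaternion_ring (residue_ring (int n))"

lemma ring_quaternion_ring:
  assumes "cring R"
  shows "ring (quaternion_ring R)"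
proof -
  interpret R: cring R by fact
  note simps = quaternion_ring_def a_minus_def R.l_distr R.r_distr R.minus_add
    R.l_minus R.r_minus R.a_ac R.m_ac
  show ?thesis
  proof (intro ringI abelian_groupI monoidI)
    fix x assume x: "x \<in> carrier (quaternion_ring R)"
    then show "\<exists>y\<in>carrier (quaternion_ring R). y \<oplus>\<^bsub>quaternion_ring R\<^esub> x = \<zero>\<^bsub>quaternion_ring R\<^esub>"
      by (intro bexI[of _ "Quat (\<ominus>\<^bsub>R\<^esub> qre x) (\<ominus>\<^bsub>R\<^esub> qi x) (\<ominus>\<^bsub>R\<^esub> qj x) (\<ominus>\<^bsub>R\<^esub> qk x)"])
        (auto simp: quaternion_ring_def R.l_neg)
  qed (auto simp: simps)
qed

lemma ring_lipschitz_ring: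
  assumes "n \<ge> 2"
  shows "ring (lipschitz_ring n)"
proof -
  interpret residues "int n" "residue_ring (int n)"
    using assms by unfold_locales auto
  show ?thesis
    unfolding lipschitz_ring_def by (rule ring_quaternion_ring) (rule cring)
qed

text \<open>The defining relations of the quaternion units.\<close>

lemma quaternion_relations:
  fixes R (structure)
  assumes "cring R"
  defines "H \<equiv> quaternion_ring R"
  defines "i \<equiv> Quat \<zero> \<one> \<zero> \<zero>"
  defines "j \<equiv> Quat \<zero> \<zero> \<one> \<zero>"
  defines "k \<equiv> Quat \<zero> \<zero> \<zero> \<one>"
  shows "i \<otimes>\<^bsub>H\<^esub> i = Quat (\<ominus> \<one>) \<zero> \<zero> \<zero>" "j \<otimes>\<^bsub>H\<^esub> j = Quat (\<ominus> \<one>) \<zero> \<zero> \<zero>" "k \<otimes>\<^bsub>H\<^esub> k = Quat (\<ominus> \<one>) \<zero> \<zero> \<zero>"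
    and "i \<otimes>\<^bsub>H\<^esub> j = k" "j \<otimes>\<^bsub>H\<^esub> i = Quat \<zero> \<zero> \<zero> (\<ominus> \<one>)"
    and "j \<otimes>\<^bsub>H\<^esub> k = i" "k \<otimes>\<^bsub>H\<^esub> j = Quat \<zero> (\<ominus> \<one>) \<zero> \<zero>"
    and "k \<otimes>\<^bsub>H\<^esub> i = j" "i \<otimes>\<^bsub>H\<^esub> k = Quat \<zero> \<zero> (\<ominus> \<one>) \<zero>"
proof -
  interpret cring R by fact
  show "i \<otimes>\<^bsub>H\<^esub> i = Quat (\<ominus> \<one>) \<zero> \<zero> \<zero>" "j \<otimes>\<^bsub>H\<^esub> j = Quat (\<ominus> \<one>) \<zero> \<zero> \<zero>" "k \<otimes>\<^bsub>H\<^esub> k = Quat (\<ominus> \<one>) \<zero> \<zero> \<zero>"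
    and "i \<otimes>\<^bsub>H\<^esub> j = k" "j \<otimes>\<^bsub>H\<^esub> i = Quat \<zero> \<zero> \<zero> (\<ominus> \<one>)"
    and "j \<otimes>\<^bsub>H\<^esub> k = i" "k \<otimes>\<^bsub>H\<^esub> j = Quat \<zero> (\<ominus> \<one>) \<zero> \<zero>"
    and "k \<otimes>\<^bsub>H\<^esub> i = j" "i \<otimes>\<^bsub>H\<^esub> k = Quat \<zero> \<zero> (\<ominus> \<one>) \<zero>"
    by (simp_all add: H_def i_def j_def k_def quaternion_ring_def a_minus_def)
qed


section \<open>The zero-divisor graph and its adjacency matrix\<close>

definition zero_divisors :: "('a, 'b) ring_scheme \<Rightarrow> 'a set" where
  "zero_divisors R = {x \<in> carrier R. x \<noteq> \<zero>\<^bsub>R\<^esub> \<and>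
     (\<exists>y\<in>carrier R. y \<noteq> \<zero>\<^bsub>R\<^esub> \<and> (x \<otimes>\<^bsub>R\<^esub> y = \<zero>\<^bsub>R\<^esub> \<or> y \<otimes>\<^bsub>R\<^esub> x = \<zero>\<^bsub>R\<^esub>))}"

text \<open>A simple undirected graph is represented, as in \<^locale>\<open>pair_graph\<close>, by a finite
  symmetric loop-free digraph: each edge is the pair of its two orientations.\<close>

definition zero_divisor_graph :: "('a, 'b) ring_scheme \<Rightarrow> 'a pair_pre_digraph" where
  "zero_divisor_graph R = \<lparr>
     pverts = zero_divisors R,
     parcs = {(x, y). x \<in> zero_divisors R \<and> y \<in> zero_divisors R \<and> x \<noteq> y \<and>
       (x \<otimes>\<^bsub>R\<^esub> y = \<zero>\<^bsub>R\<^esub> \<or> y \<otimes>\<^bsub>R\<^esub> x = \<zero>\<^bsub>R\<^esub>)}\<rparr>"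

lemma pair_graph_zero_divisor_graph:
  assumes "finite (carrier R)"
  shows "pair_graph (zero_divisor_graph R)"
proof -
  have fin: "finite (zero_divisors R)"
    using assms by (auto simp: zero_divisors_def)
  have "parcs (zero_divisor_graph R) \<subseteq> zero_divisors R \<times> zero_divisors R"
    by (auto simp: zero_divisor_graph_def)
  then have "finite (parcs (zero_divisor_graph R))"
    using fin finite_subset by blast
  moreover have "symmetric (with_proj (zero_divisor_graph R))"
    by (auto simp: symmetric_def sym_def zero_divisor_graph_def)
  ultimately show ?thesis
    using fin by unfold_locales (auto simp: zero_divisor_graph_def)
qed

lemma finite_carrier_lipschitz_ring: "finite (carrier (lipschitz_ring n))"
proof -
  let ?Z = "{0..int n - 1}"
  have "carrier (lipschitz_ring n) \<subseteq>
      (\<lambda>(a, b, c, d). Quat a b c d) ` (?Z \<times> ?Z \<times> ?Z \<times> ?Z)"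
    by (auto simp: lipschitz_ring_def quaternion_ring_def residue_ring_def image_iff)
  then show ?thesis
    by (rule finite_subset) simp
qed

text \<open>Rows and columns are indexed by the positions in \<open>vs\<close>, a list containing every vertex
  exactly once. The spectral radius does not depend on the choice of this enumeration.\<close>

definition adjacency_matrix :: "'a pair_pre_digraph \<Rightarrow> 'a list \<Rightarrow> complex mat" where
  "adjacency_matrix G vs = mat (length vs) (length vs)
     (\<lambda>(r, s). if (vs ! r, vs ! s) \<in> parcs G then 1 else 0)"

end

theory Submission
  imports Defs
begin

text \<open>
  Modulo $2^{2m+1}$, a multiple of $2^{m+1}$ times a multiple of $2^m$ vanishes. Let $B$ be the
  nonzero multiples of $2^{m+1}$ and $C$ the multiples of $2^m$ that are not multiples of
  $2^{m+1}$. Then $B$ and $C$ span a complete bipartite subgraph of the zero-divisor graph. Counting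
  the four coordinates independently, there are $2^{4m}$ multiples of $2^{m+1}$ and
  $2^{4(m+1)} = 16 \cdot 2^{4m}$ multiples of $2^m$, so $|B| = 2^{4m} - 1$ and
  $|C| = 15 \cdot 2^{4m}$. The bound is $\sqrt{|B| |C|}$, the spectral radius of the complete
  bipartite graph itself (\<open>spectral_radius_ge_complete_bipartite\<close>).

  That a subgraph bounds the spectral radius from below is an instance of the Collatz--Wielandt
  inequality (\<open>spectral_radius_nonneg_mat_ge\<close>): if $A$ is nonnegative and $Ax \ge sx$
  entrywise for a vector $x$ with a positive entry, then $\rho(A) \ge s$. Here $x$ is the Perron
  vector of the bipartite subgraph, extended by zero. The inequality is proved from the growth of
  matrix powers: if $\rho(A) < r < s$, the powers of $A/r$ stay bounded, whereas $(A/r)^k x$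
  dominates $(s/r)^k x$.
\<close>

section \<open>A lower bound for the spectral radius of a nonnegative matrix\<close>

text \<open>Applying a nonnegative matrix preserves the inequality \<open>q x \<le> M x\<close>, so it can be iterated.
  The vector is generalised in the induction because \<open>M\<^sup>k\<^sup>+\<^sup>1 x = M\<^sup>k (M x)\<close>
  calls for the hypothesis at \<open>M x\<close>. The witness \<open>z\<close> records that the complex vector has real
  entries, which makes the comparison meaningful.\<close>

lemma pow_mat_growth:
  fixes a :: "nat \<Rightarrow> nat \<Rightarrow> real" and x :: "nat \<Rightarrow> real"
  assumes a: "\<And>i j. i < n \<Longrightarrow> j < n \<Longrightarrow> 0 \<le> a i j"
    and q: "0 \<le> q"
    and x: "\<And>i. i < n \<Longrightarrow> q * x i \<le> (\<Sum>j<n. a i j * x j)"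
  defines "M \<equiv> mat n n (\<lambda>(i, j). complex_of_real (a i j))"
  shows "\<exists>z. M ^\<^sub>m k *\<^sub>v vec n (\<lambda>i. complex_of_real (x i)) = vec n (\<lambda>i. complex_of_real (z i))
    \<and> (\<forall>i<n. q ^ k * x i \<le> z i)"
  using x
proof (induction k arbitrary: x)
  case 0
  show ?case by (intro exI[of _ x]) (simp add: M_def)
next
  case (Suc k)
  define x' where "x' i = (\<Sum>j<n. a i j * x j)" for i
  have M: "M \<in> carrier_mat n n" by (simp add: M_def)
  have Mx: "M *\<^sub>v vec n (\<lambda>i. complex_of_real (x i)) = vec n (\<lambda>i. complex_of_real (x' i))"
    by (rule eq_vecI)
      (auto simp: M_def x'_def scalar_prod_def atLeast0LessThan intro!: sum.cong)
  have "q * x' i \<le> (\<Sum>j<n. a i j * x' j)" if i: "i < n" for i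
  proof -
    have "q * x' i = (\<Sum>j<n. a i j * (q * x j))"
      by (simp add: x'_def sum_distrib_left mult.left_commute)
    also have "\<dots> \<le> (\<Sum>j<n. a i j * x' j)"
      using Suc.prems a i by (intro sum_mono mult_left_mono) (auto simp: x'_def)
    finally show ?thesis .
  qed
  from Suc.IH[of x', OF this] obtain z
    where z: "M ^\<^sub>m k *\<^sub>v vec n (\<lambda>i. complex_of_real (x' i)) = vec n (\<lambda>i. complex_of_real (z i))"
      and zx: "\<And>i. i < n \<Longrightarrow> q ^ k * x' i \<le> z i" by auto
  have "q ^ Suc k * x i \<le> z i" if i: "i < n" for i
  proof -
    have "q ^ k * (q * x i) \<le> q ^ k * x' i"
      using Suc.prems[OF i] q by (intro mult_left_mono) (auto simp: x'_def)
    with zx[OF i] show ?thesis by (simp add: mult_ac)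
  qed
  moreover have "M ^\<^sub>m Suc k *\<^sub>v vec n (\<lambda>i. complex_of_real (x i))
      = vec n (\<lambda>i. complex_of_real (z i))"
    using assoc_mult_mat_vec[OF pow_carrier_mat[OF M, of k] M, of "vec n (\<lambda>i. complex_of_real (x i))"]
    by (simp add: Mx z)
  ultimately show ?case by blast
qed

text \<open>An eigenvalue \<open>e\<close> of \<open>A / r\<close> comes from the eigenvalue \<open>r * e\<close> of \<open>A\<close>, with the same
  eigenvector. This normalisation turns a gap below \<open>r\<close> into boundedness of powers.\<close>

lemma spectral_radius_smult_less_1:
  assumes A: "A \<in> carrier_mat n n" and n: "n > 0"
    and r: "spectral_radius A < r" "0 < r"
  shows "spectral_radius (complex_of_real (1 / r) \<cdot>\<^sub>m A) < 1"
proof -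
  let ?M = "complex_of_real (1 / r) \<cdot>\<^sub>m A"
  have M: "?M \<in> carrier_mat n n" using A by simp
  from spectral_radius_mem_max(1)[OF M n] obtain e v
    where e: "spectral_radius ?M = norm e" and v: "eigenvector ?M v e"
    by (auto simp: spectrum_def eigenvalue_def)
  have vc: "v \<in> carrier_vec n" and v0: "v \<noteq> 0\<^sub>v n" and ev: "?M *\<^sub>v v = e \<cdot>\<^sub>v v"
    using v M A by (auto simp: eigenvector_def)
  have "A *\<^sub>v v = (complex_of_real r * e) \<cdot>\<^sub>v v"
  proof (rule eq_vecI)
    fix i assume "i < dim_vec ((complex_of_real r * e) \<cdot>\<^sub>v v)"
    then have i: "i < n" using vc by auto
    have "complex_of_real (1 / r) * (A *\<^sub>v v) $ i = (?M *\<^sub>v v) $ i"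
      using i A vc by (simp add: scalar_prod_def sum_distrib_left mult.assoc)
    also have "\<dots> = e * v $ i" using ev i vc by simp
    finally show "(A *\<^sub>v v) $ i = ((complex_of_real r * e) \<cdot>\<^sub>v v) $ i"
      using i vc r by (simp add: field_simps)
  qed (use A vc in auto)
  then have "eigenvector A v (complex_of_real r * e)"
    using A vc v0 by (auto simp: eigenvector_def)
  then have "complex_of_real r * e \<in> spectrum A"
    unfolding spectrum_def eigenvalue_def by blast
  then have "norm (complex_of_real r * e) \<in> norm ` spectrum A" by (rule imageI)
  from spectral_radius_mem_max(2)[OF A n this] have "r * norm e \<le> spectral_radius A"
    using r(2) by (simp add: norm_mult)
  also have "\<dots> < r" by (rule r(1))
  finally show ?thesis using r(2) e by simp
qed

text \<open>The lower Collatz--Wielandt bound. If it failed, some \<open>r\<close> would lie strictly between the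
  spectral radius and \<open>s\<close>; entry \<open>i0\<close> of \<open>(A / r)\<^sup>k x\<close> would then be bounded in \<open>k\<close> by Jordan
  normal form theory, and unbounded by the growth lemma.\<close>

lemma spectral_radius_nonneg_mat_ge:
  fixes a :: "nat \<Rightarrow> nat \<Rightarrow> real" and x :: "nat \<Rightarrow> real"
  assumes a: "\<And>i j. i < n \<Longrightarrow> j < n \<Longrightarrow> 0 \<le> a i j"
    and x: "\<And>i. i < n \<Longrightarrow> s * x i \<le> (\<Sum>j<n. a i j * x j)"
    and pos: "i0 < n" "0 < x i0"
  shows "s \<le> spectral_radius (mat n n (\<lambda>(i, j). complex_of_real (a i j)))"
proof (rule ccontr)
  let ?A = "mat n n (\<lambda>(i, j). complex_of_real (a i j))"
  assume "\<not> s \<le> spectral_radius ?A"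
  then have "spectral_radius ?A < s" by simp
  then obtain r where r: "spectral_radius ?A < r" "r < s" by (auto dest: dense)
  have A: "?A \<in> carrier_mat n n" and n: "n > 0" using pos by auto
  have "0 \<le> spectral_radius ?A" using spectral_radius_mem_max(1)[OF A n] by auto
  with r have r0: "0 < r" by simp
  define b where "b i j = a i j / r" for i j
  define M where "M = mat n n (\<lambda>(i, j). complex_of_real (b i j))"
  have M: "M \<in> carrier_mat n n" by (simp add: M_def)
  have "M = complex_of_real (1 / r) \<cdot>\<^sub>m ?A"
    by (rule eq_matI) (auto simp: M_def b_def)
  then have "spectral_radius M < 1"
    using spectral_radius_smult_less_1[OF A n r(1) r0] by simp
  from spectral_radius_jnf_norm_bound_less_1_upper_triangular[OF M this]
  obtain c where c: "\<And>k. norm_bound (M ^\<^sub>m k) c" by auto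
  let ?x = "vec n (\<lambda>i. complex_of_real (x i))"
  define K where "K = (\<Sum>j<n. c * \<bar>x j\<bar>)"
  have bound: "(s / r) ^ k \<le> K / x i0" for k
  proof -
    have "\<exists>z. M ^\<^sub>m k *\<^sub>v ?x = vec n (\<lambda>i. complex_of_real (z i)) \<and> (\<forall>i<n. (s / r) ^ k * x i \<le> z i)"
      unfolding M_def
    proof (rule pow_mat_growth)
      show "0 \<le> b i j" if "i < n" "j < n" for i j using a that r0 by (simp add: b_def)
      show "0 \<le> s / r" using r r0 by simp
      show "s / r * x i \<le> (\<Sum>j<n. b i j * x j)" if "i < n" for i
        using divide_right_mono[OF x[OF that], of r] r0 by (simp add: b_def sum_divide_distrib)
    qed
    then obtain z where z: "M ^\<^sub>m k *\<^sub>v ?x = vec n (\<lambda>i. complex_of_real (z i))"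
      and zx: "(s / r) ^ k * x i0 \<le> z i0" using pos by blast
    have Mk: "M ^\<^sub>m k \<in> carrier_mat n n" using M by simp
    have "z i0 \<le> norm ((M ^\<^sub>m k *\<^sub>v ?x) $ i0)" using pos by (simp add: z)
    also have "(M ^\<^sub>m k *\<^sub>v ?x) $ i0 = (\<Sum>j<n. (M ^\<^sub>m k) $$ (i0, j) * complex_of_real (x j))"
      using pos(1) carrier_matD[OF Mk] carrier_matD[OF M]
      by (simp add: scalar_prod_def atLeast0LessThan)
    also have "norm \<dots> \<le> K"
      unfolding K_def
    proof (rule sum_norm_le)
      fix j assume "j \<in> {..<n}"
      then have "norm ((M ^\<^sub>m k) $$ (i0, j)) \<le> c"
        using c[of k] pos(1) unfolding norm_bound_def carrier_matD[OF Mk] by blast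
      then show "norm ((M ^\<^sub>m k) $$ (i0, j) * complex_of_real (x j)) \<le> c * \<bar>x j\<bar>"
        by (simp add: norm_mult mult_right_mono)
    qed
    finally show ?thesis using zx pos by (simp add: pos_le_divide_eq)
  qed
  have "1 < s / r" using r r0 by simp
  from real_arch_pow[OF this, of "K / x i0"] obtain k where "K / x i0 < (s / r) ^ k" by blast
  with bound[of k] show False by simp
qed

section \<open>Complete bipartite subgraphs\<close>

text \<open>The weight $\sqrt{|C|}$ on $B$, $\sqrt{|B|}$ on $C$ and $0$ elsewhere is the Perron vector of
  the complete bipartite graph: the neighbours in $C$ of a vertex of $B$ contribute
  $|C| \sqrt{|B|} = \sqrt{|B| |C|} \cdot \sqrt{|C|}$, and symmetrically. All further arcs of \<open>G\<close> only
  increase the row sums.\<close>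

lemma spectral_radius_ge_complete_bipartite:
  assumes vs: "distinct vs" "set vs = pverts G"
    and sub: "B \<subseteq> pverts G" "C \<subseteq> pverts G" and disj: "B \<inter> C = {}" and ne: "B \<noteq> {}" "C \<noteq> {}"
    and arcs: "B \<times> C \<subseteq> parcs G" "C \<times> B \<subseteq> parcs G"
  shows "sqrt (real (card B) * real (card C)) \<le> spectral_radius (adjacency_matrix G vs)"
proof -
  let ?n = "length vs" and ?b = "sqrt (real (card B))" and ?c = "sqrt (real (card C))"
  have fin: "finite B" "finite C" using sub vs(2) finite_subset by (metis List.finite_set)+
  define a :: "nat \<Rightarrow> nat \<Rightarrow> real"
    where "a i j = (if (vs ! i, vs ! j) \<in> parcs G then 1 else 0)" for i j
  define w where "w v = (if v \<in> B then ?c else if v \<in> C then ?b else 0)" for v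
  have w0: "0 \<le> w v" for v by (simp add: w_def)
  have A: "adjacency_matrix G vs = mat ?n ?n (\<lambda>(i, j). complex_of_real (a i j))"
    unfolding adjacency_matrix_def by (rule eq_matI) (auto simp: a_def)
  \<comment> \<open>A row sum over positions is at least the total weight of any set of out-neighbours.\<close>
  have row: "(\<Sum>v\<in>D. w v) \<le> (\<Sum>j<?n. a i j * w (vs ! j))"
    if i: "i < ?n" and D: "D \<subseteq> set vs" "{vs ! i} \<times> D \<subseteq> parcs G" for i D
  proof -
    have "(\<Sum>v\<in>D. w v) = (\<Sum>v\<in>D. (if (vs ! i, v) \<in> parcs G then 1 else 0) * w v)"
      using D by (intro sum.cong) auto
    also have "\<dots> \<le> (\<Sum>v\<in>set vs. (if (vs ! i, v) \<in> parcs G then 1 else 0) * w v)"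
      using D w0 by (intro sum_mono2) auto
    also have "\<dots> = (\<Sum>j<?n. a i j * w (vs ! j))"
      unfolding a_def
      by (rule sum.reindex_bij_betw[OF bij_betw_nth[OF vs(1) refl refl], symmetric])
    finally show ?thesis .
  qed
  from ne(1) obtain v0 where "v0 \<in> B" by auto
  then obtain i0 where i0: "i0 < ?n" "vs ! i0 \<in> B"
    using sub vs(2) by (metis in_set_conv_nth subsetD)
  show ?thesis
    unfolding A
  proof (rule spectral_radius_nonneg_mat_ge)
    show "0 \<le> a i j" for i j by (simp add: a_def)
    show "i0 < ?n" by fact
    show "0 < w (vs ! i0)" using i0 ne fin by (simp add: w_def card_gt_0_iff)
    fix i assume i: "i < ?n"
    consider "vs ! i \<in> B" | "vs ! i \<notin> B" "vs ! i \<in> C" | "vs ! i \<notin> B" "vs ! i \<notin> C" by blast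
    then show "sqrt (real (card B) * real (card C)) * w (vs ! i) \<le> (\<Sum>j<?n. a i j * w (vs ! j))"
    proof cases
      case 1
      have "(\<Sum>v\<in>C. w v) = (\<Sum>v\<in>C. ?b)"
        using disj by (intro sum.cong) (auto simp: w_def)
      then have "sqrt (real (card B) * real (card C)) * w (vs ! i) = (\<Sum>v\<in>C. w v)"
        using 1 by (simp add: w_def real_sqrt_mult)
      also have "\<dots> \<le> (\<Sum>j<?n. a i j * w (vs ! j))"
        using 1 arcs sub vs by (intro row i) auto
      finally show ?thesis .
    next
      case 2
      have "(\<Sum>v\<in>B. w v) = (\<Sum>v\<in>B. ?c)"
        by (intro sum.cong) (auto simp: w_def)
      then have "sqrt (real (card B) * real (card C)) * w (vs ! i) = (\<Sum>v\<in>B. w v)"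
        using 2 by (simp add: w_def real_sqrt_mult)
      also have "\<dots> \<le> (\<Sum>j<?n. a i j * w (vs ! j))"
        using 2 arcs sub vs by (intro row i) auto
      finally show ?thesis .
    next
      case 3
      then show ?thesis by (simp add: w_def w0 a_def sum_nonneg)
    qed
  qed
qed

section \<open>Multiples of a divisor of the modulus among the Lipschitz quaternions\<close>

definition lipschitz_multiples :: "nat \<Rightarrow> nat \<Rightarrow> int quat set" where
  "lipschitz_multiples n d = {x \<in> carrier (lipschitz_ring n).
     int d dvd qre x \<and> int d dvd qi x \<and> int d dvd qj x \<and> int d dvd qk x}"

text \<open>A multiple of \<open>d\<close> among the residues modulo \<open>d * e\<close> is \<open>d\<close> times a unique residue modulo
  \<open>e\<close>, and the four coordinates are chosen independently.\<close>

lemma card_lipschitz_multiples: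
  assumes "0 < d"
  shows "card (lipschitz_multiples (d * e) d) = e ^ 4"
proof -
  let ?E = "{0..<int e}"
  let ?f = "\<lambda>(a, b, c, k). Quat (int d * a) (int d * b) (int d * c) (int d * k)"
  have range: "int d * a \<in> {0..int d * int e - 1} \<longleftrightarrow> a \<in> ?E" for a
    using assms by (auto simp: zero_le_mult_iff)
  have mem: "Quat (int d * a) (int d * b) (int d * c) (int d * k) \<in> lipschitz_multiples (d * e) d
      \<longleftrightarrow> a \<in> ?E \<and> b \<in> ?E \<and> c \<in> ?E \<and> k \<in> ?E" for a b c k
    unfolding range[symmetric]
    by (simp add: lipschitz_multiples_def lipschitz_ring_def quaternion_ring_def residue_ring_def)
  have "lipschitz_multiples (d * e) d = ?f ` (?E \<times> ?E \<times> ?E \<times> ?E)"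
  proof (intro equalityI subsetI)
    fix x assume x: "x \<in> lipschitz_multiples (d * e) d"
    then have "int d dvd qre x" "int d dvd qi x" "int d dvd qj x" "int d dvd qk x"
      by (simp_all add: lipschitz_multiples_def)
    then obtain a b c k where "qre x = int d * a" "qi x = int d * b" "qj x = int d * c"
      "qk x = int d * k" by (elim dvdE)
    then have eq: "x = Quat (int d * a) (int d * b) (int d * c) (int d * k)"
      by (simp add: quat.expand)
    have "a \<in> ?E" "b \<in> ?E" "c \<in> ?E" "k \<in> ?E"
      using x unfolding eq mem by simp_all
    then show "x \<in> ?f ` (?E \<times> ?E \<times> ?E \<times> ?E)"
      by (intro image_eqI[of _ _ "(a, b, c, k)"]) (simp_all add: eq)
  next
    fix x assume "x \<in> ?f ` (?E \<times> ?E \<times> ?E \<times> ?E)"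
    then show "x \<in> lipschitz_multiples (d * e) d"
      using mem by fast
  qed
  moreover have "inj_on ?f (?E \<times> ?E \<times> ?E \<times> ?E)"
    using assms by (auto simp: inj_on_def)
  ultimately show ?thesis
    by (simp add: card_image card_cartesian_product power4_eq_xxxx)
qed

text \<open>Every coordinate of the product is a signed sum of products of one coordinate of \<open>x\<close> and one
  of \<open>y\<close>, each of which vanishes modulo \<open>n\<close> already.\<close>

lemma mult_lipschitz_multiples:
  assumes n: "n \<ge> 2" "n dvd d * e"
    and x: "x \<in> lipschitz_multiples n d" and y: "y \<in> lipschitz_multiples n e"
  shows "x \<otimes>\<^bsub>lipschitz_ring n\<^esub> y = \<zero>\<^bsub>lipschitz_ring n\<^esub>"
proof -
  interpret residues "int n" "residue_ring (int n)"
    using n by unfold_locales auto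
  have prod: "a \<otimes>\<^bsub>residue_ring (int n)\<^esub> b = \<zero>\<^bsub>residue_ring (int n)\<^esub>" if "int d dvd a" "int e dvd b" for a b
  proof -
    have "int n dvd int d * int e" using n(2) by (metis of_nat_dvd_iff of_nat_mult)
    with that have "int n dvd a * b" by (meson dvd_trans mult_dvd_mono)
    then show ?thesis by (simp add: res_mult_eq res_zero_eq)
  qed
  show ?thesis
    using x y by (simp add: lipschitz_multiples_def lipschitz_ring_def quaternion_ring_def prod a_minus_def)
qed

section \<open>The zero-divisor graph modulo an odd power of two\<close>

theorem corollary5p6:
  fixes m t :: nat and vs :: "int quat list"
  assumes "t = 2 * m + 1" and "t \<ge> 3"
    and "distinct vs" and "set vs = pverts (zero_divisor_graph (lipschitz_ring (2 ^ t)))"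
  shows "spectral_radius (adjacency_matrix (zero_divisor_graph (lipschitz_ring (2 ^ t))) vs)
           \<ge> sqrt (15 * 2 ^ (4 * m) * (2 ^ (4 * m) - 1))
       \<and> sqrt (15 * 2 ^ (4 * m) * (2 ^ (4 * m) - 1)) > (2 :: real) ^ (4 * m) - 2"
proof
  let ?n = "2 ^ t :: nat" and ?N = "2 ^ (4 * m) :: nat"
  let ?R = "lipschitz_ring ?n" and ?L = "lipschitz_multiples ?n"
  let ?G = "zero_divisor_graph ?R"
  have m: "m \<ge> 1" using assms(1,2) by simp
  have "(2::nat) ^ (4 * 1) \<le> ?N" using m by (intro power_increasing) auto
  then have N: "16 \<le> ?N" by simp
  have "(2::nat) ^ 1 \<le> ?n" using assms(2) by (intro power_increasing) auto
  then have n2: "2 \<le> ?n" by simp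
  have n: "?n = 2 ^ (m + 1) * 2 ^ m" "?n = 2 ^ m * 2 ^ (m + 1)"
    unfolding assms(1) by (simp_all flip: power_add)
  define B where "B = ?L (2 ^ (m + 1)) - {\<zero>\<^bsub>?R\<^esub>}"
  define C where "C = ?L (2 ^ m) - ?L (2 ^ (m + 1))"
  have carrier: "?L d \<subseteq> carrier ?R" for d by (auto simp: lipschitz_multiples_def)
  have fin: "finite (?L d)" for d
    using carrier finite_carrier_lipschitz_ring by (rule finite_subset)
  have zero: "\<zero>\<^bsub>?R\<^esub> \<in> ?L d" for d
    using n2 by (auto simp: lipschitz_multiples_def lipschitz_ring_def quaternion_ring_def residue_ring_def)
  have mono: "?L (2 ^ (m + 1)) \<subseteq> ?L (2 ^ m)"
    by (auto simp: lipschitz_multiples_def dest: dvd_mult_left dvd_mult_right)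
  have cardL: "card (?L (2 ^ (m + 1))) = ?N" "card (?L (2 ^ m)) = 16 * ?N"
    using card_lipschitz_multiples[of "2 ^ (m + 1)" "2 ^ m"]
      card_lipschitz_multiples[of "2 ^ m" "2 ^ (m + 1)"]
    by (simp_all add: n power_mult_distrib mult.commute flip: power_mult)
  have cardB: "card B = ?N - 1"
    using cardL zero by (simp add: B_def card_Diff_singleton)
  have cardC: "card C = 15 * ?N"
    using cardL mono fin by (simp add: C_def card_Diff_subset)
  \<comment> \<open>Nonemptiness of \<open>B\<close> is where \<open>m \<ge> 1\<close> matters. Each part then supplies the annihilators that
    make the elements of the other part zero divisors.\<close>
  have ne: "B \<noteq> {}" "C \<noteq> {}" using cardB cardC N by auto
  have disj: "B \<inter> C = {}" by (auto simp: B_def C_def)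
  have prod: "x \<otimes>\<^bsub>?R\<^esub> y = \<zero>\<^bsub>?R\<^esub>" if "x \<in> B" "y \<in> C" for x y
  proof (rule mult_lipschitz_multiples[OF n2])
    show "?n dvd 2 ^ (m + 1) * 2 ^ m" unfolding n(1)[symmetric] by (rule dvd_refl)
    show "x \<in> ?L (2 ^ (m + 1))" "y \<in> ?L (2 ^ m)" using that by (auto simp: B_def C_def)
  qed
  have nz: "x \<in> carrier ?R" "x \<noteq> \<zero>\<^bsub>?R\<^esub>" if "x \<in> B \<union> C" for x
    using that carrier zero by (auto simp: B_def C_def)
  have "x \<in> zero_divisors ?R" if "x \<in> B" for x
    using that ne(2) prod nz unfolding zero_divisors_def by blast
  moreover have "x \<in> zero_divisors ?R" if "x \<in> C" for x
    using that ne(1) prod nz unfolding zero_divisors_def by blast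
  ultimately have zd: "B \<subseteq> zero_divisors ?R" "C \<subseteq> zero_divisors ?R" by auto
  have "sqrt (real (card B) * real (card C)) \<le> spectral_radius (adjacency_matrix ?G vs)"
  proof (rule spectral_radius_ge_complete_bipartite)
    show "B \<times> C \<subseteq> parcs ?G" "C \<times> B \<subseteq> parcs ?G"
      using zd prod disj by (auto simp: zero_divisor_graph_def)
  qed (use assms(3,4) zd disj ne in \<open>auto simp: zero_divisor_graph_def\<close>)
  also have "real (card B) * real (card C) = 15 * 2 ^ (4 * m) * (2 ^ (4 * m) - 1)"
    by (simp add: cardB cardC of_nat_diff)
  finally show "sqrt (15 * 2 ^ (4 * m) * (2 ^ (4 * m) - 1))
    \<le> spectral_radius (adjacency_matrix ?G vs)" .
  define M where "M = (2 :: real) ^ (4 * m)"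
  have M: "16 \<le> M" using N unfolding M_def by (metis of_nat_le_iff of_nat_numeral of_nat_power)
  have "(M - 2)\<^sup>2 \<le> M * (M - 1)" using M by (simp add: power2_eq_square algebra_simps)
  also have "\<dots> < 15 * M * (M - 1)" using M by simp
  finally have "M - 2 < sqrt (15 * M * (M - 1))" by (rule real_less_rsqrt)
  then show "sqrt (15 * 2 ^ (4 * m) * (2 ^ (4 * m) - 1)) > (2 :: real) ^ (4 * m) - 2"
    by (simp add: M_def)
qed

end
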